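(* Let $(\widehat{\mathit{Init}},\widehat{\delta},\widehat{\mathit{Bad}})$ be obtained by instrumenting a transition system $(\mathit{Init},\delta,\mathit{Bad})$ over $\Sigma$ with a new variable $q$ capturing $\neg p$, where $p\in\Sigma$, and let $I$ be an inductive invariant for $(\mathit{Init},\delta,\mathit{Bad})$ in negation normal form (negations appear only on atomic variables). Let $\widehat{I}$ be obtained from $I$ by replacing every (positive) occurrence of $p$ in $I$ with $\neg q$ (literals $\neg p$ are left unchanged). Suppose that there is a state $\sigma$ over $\Sigma$ such that $\sigma\models I$ and $\sigma[p\mapsto\mathit{true}]\models\neg I$. Then $\widehat{I}$ is not forwards $k$-fenced in $(\widehat{\mathit{Init}},\widehat{\delta},\widehat{\mathit{Bad}})$ for any $k\in\mathbb{N}$; that is, for every $k\in\mathbb{N}$, $\partial^+(\widehat I)\not\subseteq\widehat\delta^{\le k}(\widehat{\mathit{Init}})$, where states and boundary are over $\widehat\Sigma=\Sigma\uplus\{q\}$.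
   Context: Transition systems. $\Sigma$ is a finite set of Boolean variables; a state is a valuation of $\Sigma$, and $\sigma[p\mapsto z]$ is $\sigma$ with $p$ reassigned to $z$; a formula over $\Sigma$ is identified with the set of states satisfying it, and $\varphi\Longrightarrow\psi$ means that $\varphi\to\psi$ is valid. A transition system is a triple $(\mathit{Init},\delta,\mathit{Bad})$ with $\mathit{Init},\mathit{Bad}$ formulas over $\Sigma$ and $\delta$ a formula over $\Sigma\uplus\Sigma'$ ($\Sigma'$ a primed copy), describing pairs (pre-state, post-state). Standing assumptions: $\mathit{Init}\not\equiv\mathit{false}$, $\mathit{Bad}\not\equiv\mathit{true},\mathit{false}$, $\mathit{Init}\Longrightarrow\neg\mathit{Bad}$. An inductive invariant is a formula $I$ with (i) $\mathit{Init}\Longrightarrow I$, (ii) $I\wedge\delta\Longrightarrow I'$, (iii) $I\Longrightarrow\neg\mathit{Bad}$, where $I'$ is $I$ with variables primed. $\delta^{\le k}(S)$ is the set of states reachable from some state in $S$ in at most $k$ steps of $\delta$. Two states are neighbors if they differ in exactly one variable. $\partial^+(I)=\{\sigma\models I : \sigma\text{ has a neighbor }\not\models I\}$. $I$ is forwards $k$-fenced in $(\mathit{Init},\delta,\mathit{Bad})$ if $\partial^+(I)\subseteq\delta^{\le k}(\mathit{Init})$. Instrumentation with $q$ capturing $\neg p$: the vocabulary becomes $\widehat\Sigma=\Sigma\uplus\{q\}$, $\widehat{\mathit{Init}}=\mathit{Init}\wedge(p\leftrightarrow\neg q)$, $\widehat\delta=(p\leftrightarrow\neg q)\wedge\delta\wedge(p'\leftrightarrow\neg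 q')$. The set $\widehat{\mathit{Bad}}$ (e.g. $\mathit{Bad}$ or $\mathit{Bad}\wedge(p\leftrightarrow\neg q)$) plays no role in the notion of being forwards fenced. *)

theory Defs
  imports Main
begin

text \<open>A finite vocabulary is a finite type \<open>'v\<close>; a state is a valuation \<open>'v \<Rightarrow> bool\<close>.\<close>

datatype 'v form =
    TT
  | FF
  | Var 'v
  | Neg "'v form"
  | And "'v form" "'v form"
  | Or "'v form" "'v form"

type_synonym 'v state = "'v \<Rightarrow> bool"

primrec sat :: "'v state \<Rightarrow> 'v form \<Rightarrow> bool" (infix "\<Turnstile>" 50) where
  "\<sigma> \<Turnstile> TT \<longleftrightarrow> True"
| "\<sigma> \<Turnstile> FF \<longleftrightarrow> False"
| "\<sigma> \<Turnstile> Var x \<longleftrightarrow> \<sigma> x"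
| "\<sigma> \<Turnstile> Neg \<phi> \<longleftrightarrow> \<not> \<sigma> \<Turnstile> \<phi>"
| "\<sigma> \<Turnstile> And \<phi> \<psi> \<longleftrightarrow> \<sigma> \<Turnstile> \<phi> \<and> \<sigma> \<Turnstile> \<psi>"
| "\<sigma> \<Turnstile> Or \<phi> \<psi> \<longleftrightarrow> \<sigma> \<Turnstile> \<phi> \<or> \<sigma> \<Turnstile> \<psi>"

definition Imp :: "'v form \<Rightarrow> 'v form \<Rightarrow> 'v form" where
  "Imp \<phi> \<psi> = Or (Neg \<phi>) \<psi>"

definition Iff :: "'v form \<Rightarrow> 'v form \<Rightarrow> 'v form" where
  "Iff \<phi> \<psi> = And (Imp \<phi> \<psi>) (Imp \<psi> \<phi>)"

definition valid :: "'v form \<Rightarrow> bool" where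
  "valid \<phi> \<longleftrightarrow> (\<forall>\<sigma>. \<sigma> \<Turnstile> \<phi>)"

definition entails :: "'v form \<Rightarrow> 'v form \<Rightarrow> bool" where
  "entails \<phi> \<psi> \<longleftrightarrow> valid (Imp \<phi> \<psi>)"

definition equivalent :: "'v form \<Rightarrow> 'v form \<Rightarrow> bool" where
  "equivalent \<phi> \<psi> \<longleftrightarrow> valid (Iff \<phi> \<psi>)"

fun nnf :: "'v form \<Rightarrow> bool" where
  "nnf TT \<longleftrightarrow> True"
| "nnf FF \<longleftrightarrow> True"
| "nnf (Var x) \<longleftrightarrow> True"
| "nnf (Neg (Var x)) \<longleftrightarrow> True"
| "nnf (Neg _) \<longleftrightarrow> False"
| "nnf (And \<phi> \<psi>) \<longleftrightarrow> nnf \<phi> \<and> nnf \<psi>"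
| "nnf (Or \<phi> \<psi>) \<longleftrightarrow> nnf \<phi> \<and> nnf \<psi>"

text \<open>The two-state vocabulary is \<open>'v + 'v\<close>: \<open>Inl x\<close> is \<open>x\<close> in the pre-state and
  \<open>Inr x\<close> is the primed copy of \<open>x\<close>.\<close>

record 'v ts =
  Init :: "'v form"
  Trans :: "('v + 'v) form"
  Bad :: "'v form"

abbreviation unprimed :: "'v form \<Rightarrow> ('v + 'v) form" where
  "unprimed \<equiv> map_form Inl"

abbreviation primed :: "'v form \<Rightarrow> ('v + 'v) form" where
  "primed \<equiv> map_form Inr"

definition transition_system :: "'v ts \<Rightarrow> bool" where
  "transition_system T \<longleftrightarrow>
     \<not> equivalent (Init T) FF \<and>
     \<not> equivalent (Bad T) TT \<and> \<not> equivalent (Bad T) FF \<and>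
     entails (Init T) (Neg (Bad T))"

definition inductive_invariant :: "'v ts \<Rightarrow> 'v form \<Rightarrow> bool" where
  "inductive_invariant T I \<longleftrightarrow>
     entails (Init T) I \<and>
     entails (And (unprimed I) (Trans T)) (primed I) \<and>
     entails I (Neg (Bad T))"

definition step_rel :: "('v + 'v) form \<Rightarrow> ('v state \<times> 'v state) set" where
  "step_rel \<delta> = {(\<sigma>, \<sigma>'). case_sum \<sigma> \<sigma>' \<Turnstile> \<delta>}"

definition reach_le :: "('v + 'v) form \<Rightarrow> nat \<Rightarrow> 'v state set \<Rightarrow> 'v state set" where
  "reach_le \<delta> k S = {\<tau>. \<exists>\<sigma>\<in>S. \<exists>j\<le>k. (\<sigma>, \<tau>) \<in> step_rel \<delta> ^^ j}"

definition neighbors :: "'v state \<Rightarrow> 'v state \<Rightarrow> bool" where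
  "neighbors \<sigma> \<tau> \<longleftrightarrow> (\<exists>!x. \<sigma> x \<noteq> \<tau> x)"

definition inner_boundary :: "'v form \<Rightarrow> 'v state set" where
  "inner_boundary I = {\<sigma>. \<sigma> \<Turnstile> I \<and> (\<exists>\<tau>. neighbors \<sigma> \<tau> \<and> \<not> \<tau> \<Turnstile> I)}"

definition forwards_fenced :: "nat \<Rightarrow> 'v ts \<Rightarrow> 'v form \<Rightarrow> bool" where
  "forwards_fenced k T I \<longleftrightarrow>
     inner_boundary I \<subseteq> reach_le (Trans T) k {\<sigma>. \<sigma> \<Turnstile> Init T}"

text \<open>The vocabulary extended by one new variable \<open>q\<close> is \<open>'v option\<close>: \<open>None\<close> is \<open>q\<close> and
  \<open>Some x\<close> is the old variable \<open>x\<close>.\<close>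

definition captures_neg :: "'v \<Rightarrow> 'v option form" where
  "captures_neg p = Iff (Var (Some p)) (Neg (Var None))"

text \<open>The bad states of the instrumented system are left as a parameter \<open>B\<close>, since they are
  irrelevant for being forwards fenced.\<close>

definition instrument :: "'v \<Rightarrow> 'v option form \<Rightarrow> 'v ts \<Rightarrow> 'v option ts" where
  "instrument p B T =
     \<lparr>Init = And (map_form Some (Init T)) (captures_neg p),
      Trans = And (unprimed (captures_neg p))
                (And (map_form (map_sum Some Some) (Trans T)) (primed (captures_neg p))),
      Bad = B\<rparr>"

text \<open>The flag records the polarity of the current subformula: \<open>replace_occs True p \<phi>\<close> replaces
  the positive occurrences of \<open>p\<close> in \<open>\<phi>\<close>, \<open>replace_occs False p \<phi>\<close> the negative ones.\<close>

primrec replace_occs :: "bool \<Rightarrow> 'v \<Rightarrow> 'v form \<Rightarrow> 'v option form" where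
  "replace_occs b p TT = TT"
| "replace_occs b p FF = FF"
| "replace_occs b p (Var x) = (if b \<and> x = p then Neg (Var None) else Var (Some x))"
| "replace_occs b p (Neg \<phi>) = Neg (replace_occs (\<not> b) p \<phi>)"
| "replace_occs b p (And \<phi> \<psi>) = And (replace_occs b p \<phi>) (replace_occs b p \<psi>)"
| "replace_occs b p (Or \<phi> \<psi>) = Or (replace_occs b p \<phi>) (replace_occs b p \<psi>)"

abbreviation replace_pos :: "'v \<Rightarrow> 'v form \<Rightarrow> 'v option form" where
  "replace_pos \<equiv> replace_occs True"

end

theory Submission imports Defs begin

text \<open>A positive occurrence of \<open>p\<close> reads \<open>\<not> q\<close> in \<open>replace_pos p I\<close> and a negative one
  reads \<open>p\<close>, so \<open>replace_pos p I\<close> agrees with \<open>I\<close> wherever \<open>p \<longleftrightarrow> \<not> q\<close>, and it is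
  preserved when \<open>q\<close> is made false. The given \<open>\<sigma>\<close> has \<open>p\<close> false. Extending it with \<open>q\<close> true
  satisfies \<open>replace_pos p I\<close>, hence so does extending it with \<open>q\<close> false; raising
  \<open>p\<close> then leads to the extension of \<open>\<sigma>(p := True)\<close>, which violates it. The boundary state with
  both \<open>p\<close> and \<open>q\<close> false is never reached, because \<open>p \<longleftrightarrow> \<not> q\<close> holds initially
  and after every step.\<close>

lemma sat_map_form: "\<sigma> \<Turnstile> map_form f \<phi> \<longleftrightarrow> (\<sigma> \<circ> f) \<Turnstile> \<phi>"
  by (induction \<phi>) auto

lemma sat_captures_neg: "\<tau> \<Turnstile> captures_neg p \<longleftrightarrow> \<tau> (Some p) = (\<not> \<tau> None)"
  by (auto simp: captures_neg_def Iff_def Imp_def)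

lemma sat_replace_occs:
  assumes "\<tau> \<Turnstile> captures_neg p"
  shows "\<tau> \<Turnstile> replace_occs b p \<phi> \<longleftrightarrow> (\<tau> \<circ> Some) \<Turnstile> \<phi>"
  using assms by (induction \<phi> arbitrary: b) (auto simp: sat_captures_neg)

text \<open>\<open>Neg\<close> flips the flag and reverses the implication, so both polarities share
  one induction.\<close>

lemma sat_replace_occs_clear:
  "(\<tau> \<Turnstile> replace_occs True p \<phi> \<longrightarrow> \<tau>(None := False) \<Turnstile> replace_occs True p \<phi>) \<and>
   (\<tau>(None := False) \<Turnstile> replace_occs False p \<phi> \<longrightarrow> \<tau> \<Turnstile> replace_occs False p \<phi>)"
  by (induction \<phi>) (auto simp del: fun_upd_apply simp: fun_upd_same fun_upd_other)

lemma step_rel_instrument_captures_neg: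
  assumes "(\<sigma>, \<tau>) \<in> step_rel (Trans (instrument p B T))"
  shows "\<tau> \<Turnstile> captures_neg p"
  using assms by (simp add: step_rel_def instrument_def sat_map_form comp_def)

lemma reach_le_instrument_captures_neg:
  assumes "\<tau> \<in> reach_le (Trans (instrument p B T)) k {\<sigma>. \<sigma> \<Turnstile> Init (instrument p B T)}"
  shows "\<tau> \<Turnstile> captures_neg p"
proof -
  obtain \<sigma> j where \<sigma>: "\<sigma> \<Turnstile> Init (instrument p B T)"
    and j: "(\<sigma>, \<tau>) \<in> step_rel (Trans (instrument p B T)) ^^ j"
    using assms by (auto simp: reach_le_def)
  \<comment> \<open>For \<open>j = 0\<close> the constraint comes from \<open>Init\<close>,
    otherwise from the last step.\<close>
  show ?thesis
  proof (cases j)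
    case 0
    with \<sigma> j show ?thesis by (simp add: instrument_def)
  next
    case (Suc i)
    with j show ?thesis by (auto dest: step_rel_instrument_captures_neg)
  qed
qed

theorem lemma8p2:
  fixes T :: "'v::finite ts" and p :: 'v and I :: "'v form" and B :: "'v option form"
  assumes "transition_system T"
    and "inductive_invariant T I"
    and "nnf I"
    and "\<exists>\<sigma>. \<sigma> \<Turnstile> I \<and> \<sigma>(p := True) \<Turnstile> Neg I"
  shows "\<forall>k. \<not> forwards_fenced k (instrument p B T) (replace_pos p I)"
proof -
  obtain \<sigma> where \<sigma>: "\<sigma> \<Turnstile> I" "\<not> \<sigma>(p := True) \<Turnstile> I"
    using assms(4) by auto
  \<comment> \<open>Otherwise the update would leave \<open>\<sigma>\<close> unchanged.\<close>
  have p: "\<not> \<sigma> p"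
    using \<sigma> by (metis (full_types) fun_upd_triv)
  \<comment> \<open>The first argument of \<open>case_option\<close> is the value of
    \<open>q\<close>. Only \<open>?\<rho>\<close> satisfies \<open>captures_neg p\<close>.\<close>
  let ?\<tau> = "case_option False \<sigma>" and ?\<rho> = "case_option False (\<sigma>(p := True))"
  have "case_option True \<sigma> \<Turnstile> replace_pos p I"
    using \<sigma>(1) p by (simp add: sat_replace_occs sat_captures_neg comp_def)
  moreover have "(case_option True \<sigma>)(None := False) = ?\<tau>"
    by (auto split: option.splits)
  ultimately have "?\<tau> \<Turnstile> replace_pos p I"
    using sat_replace_occs_clear by metis
  moreover have "\<not> ?\<rho> \<Turnstile> replace_pos p I"
    using \<sigma>(2) by (simp add: sat_replace_occs sat_captures_neg comp_def del: fun_upd_apply add: fun_upd_same)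
  moreover have "neighbors ?\<tau> ?\<rho>"
    unfolding neighbors_def
    by (rule ex1I[of _ "Some p"]) (use p in \<open>auto split: option.splits if_splits\<close>)
  ultimately have "?\<tau> \<in> inner_boundary (replace_pos p I)"
    by (auto simp: inner_boundary_def)
  moreover have "\<not> ?\<tau> \<Turnstile> captures_neg p"
    using p by (simp add: sat_captures_neg)
  ultimately show ?thesis
    by (auto simp: forwards_fenced_def dest: reach_le_instrument_captures_neg)
qed

end
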